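(* Let $k\ge 1$ and let $\mu$ be a $\sigma$-finite Borel measure on $M_k$ whose support contains more than one point. Then the set of $L\in\mathcal{B}(M_k)$ such that the pair $(L,\mu)$ satisfies the purification condition is generic in $\mathcal{B}(M_k)$, i.e. it contains a countable intersection of open dense subsets of $\mathcal{B}(M_k)$.
   Context: $M_k$ is the space of complex $k\times k$ matrices with its Borel $\sigma$-algebra and the Hilbert-Schmidt norm $\|A\|=\sqrt{\mathrm{tr}(AA^* )}$. $\mathcal{B}(M_k)$ is the set of continuous bounded functions $L:M_k\to M_k$, with norm $\|L\|=\sup_{v\in M_k}\|L(v)\|$. For $n\in\mathbb{N}=\{1,2,\dots\}$ and $\omega=(\omega_1,\dots,\omega_n)\in M_k^n$ put $W_n(\omega)=L(\omega_n)\cdots L(\omega_1)$. For operators write $A\propto B$ if there is $\beta\in\mathbb{C}$ with $A=\beta B$. The pair $(L,\mu)$ satisfies the purification condition if every nonzero orthogonal projector $\pi$ on $\mathbb{C}^k$ such that, for every $n\in\mathbb{N}$, $\pi W_n(\omega)^*W_n(\omega)\pi\propto\pi$ for $\mu^{\otimes n}$-almost every $\omega$, has rank one. *)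

theory Defs
  imports "HOL-Analysis.Analysis"
begin

text \<open>The space of complex square matrices is the type \<open>complex^'k^'k\<close>. Its library norm is
  the Hilbert-Schmidt norm (lemma \<open>norm_eq_Hilbert_Schmidt\<close>), and the space of bounded continuous
  maps is the library type \<open>(complex^'k^'k) \<Rightarrow>\<^sub>C (complex^'k^'k)\<close>, with the supremum norm.\<close>

definition ctranspose :: "complex^'n^'m \<Rightarrow> complex^'m^'n" where
  "ctranspose A = (\<chi> i j. cnj (A $ j $ i))"

lemma norm_eq_Hilbert_Schmidt:
  fixes A :: "complex^'k^'k"
  shows "complex_of_real (norm A) ^ 2 = trace (A ** ctranspose A)"
    and "norm A = sqrt (Re (trace (A ** ctranspose A)))"
proof -
  have n2: "(norm A)\<^sup>2 = (\<Sum>i\<in>UNIV. \<Sum>j\<in>UNIV. (cmod (A $ i $ j))\<^sup>2)"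
    by (simp add: norm_vec_def L2_set_def sum_nonneg)
  show *: "complex_of_real (norm A) ^ 2 = trace (A ** ctranspose A)"
    unfolding of_real_power[symmetric] n2
    by (simp add: trace_def matrix_matrix_mult_def ctranspose_def complex_norm_square
        del: of_real_power)
  have "Re (trace (A ** ctranspose A)) = (norm A)\<^sup>2"
    unfolding *[symmetric] by (metis Re_complex_of_real of_real_power)
  then show "norm A = sqrt (Re (trace (A ** ctranspose A)))"
    by simp
qed

definition orthogonal_projector :: "complex^'k^'k \<Rightarrow> bool" where
  "orthogonal_projector P \<longleftrightarrow> P ** P = P \<and> ctranspose P = P"

definition prop_to :: "complex^'n^'m \<Rightarrow> complex^'n^'m \<Rightarrow> bool" (infix \<open>\<propto>\<close> 50) where
  "A \<propto> B \<longleftrightarrow> (\<exists>\<beta>::complex. A = (\<chi> i j. \<beta> * B $ i $ j))"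

text \<open>\<open>W L n \<omega> = L (\<omega> n) ** \<dots> ** L (\<omega> 1)\<close>: the latest factor is multiplied on the left,
  and tuples are indexed by \<open>{1..n}\<close>.\<close>

primrec W :: "(complex^'k^'k \<Rightarrow> complex^'k^'k) \<Rightarrow> nat \<Rightarrow> (nat \<Rightarrow> complex^'k^'k) \<Rightarrow> complex^'k^'k"
where
  "W L 0 \<omega> = mat 1"
| "W L (Suc n) \<omega> = L (\<omega> (Suc n)) ** W L n \<omega>"

definition purification ::
  "(complex^'k^'k \<Rightarrow> complex^'k^'k) \<Rightarrow> (complex^'k^'k) measure \<Rightarrow> bool"
where
  "purification L \<mu> \<longleftrightarrow>
    (\<forall>\<pi>. orthogonal_projector \<pi> \<and> \<pi> \<noteq> 0 \<and>
         (\<forall>n\<ge>1. AE \<omega> in (\<Pi>\<^sub>M i\<in>{1..n}. \<mu>).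
            \<pi> ** ctranspose (W L n \<omega>) ** W L n \<omega> ** \<pi> \<propto> \<pi>)
       \<longrightarrow> rank \<pi> = 1)"

definition measure_support :: "'a::topological_space measure \<Rightarrow> 'a set" where
  "measure_support M = {x. \<forall>U. open U \<and> x \<in> U \<longrightarrow> emeasure M U > 0}"

definition generic :: "'a::topological_space set \<Rightarrow> bool" where
  "generic S \<longleftrightarrow>
    (\<exists>\<U>. countable \<U> \<and> (\<forall>U\<in>\<U>. open U \<and> closure U = UNIV) \<and> \<Inter>\<U> \<subseteq> S)"

end

theory Submission
  imports Defs "HOL-Computational_Algebra.Fundamental_Theorem_Algebra"
begin

text \<open>The value of \<open>L\<close> at one point \<open>x\<close> of the support can force purification.
  An almost sure closed condition on \<open>\<omega>\<close> holds at every tuple of support points, because each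
  neighbourhood of such a tuple contains a box of positive product measure; at the constant tuple
  \<open>(x, \<dots>, x)\<close> the product \<open>W\<^sub>n\<close> is the power \<open>A\<^sup>n\<close> of \<open>A = L x\<close>. A projector of rank at least
  two that violates purification therefore yields a plane on which every \<open>A\<^sup>n\<close> is a scalar
  multiple of an isometry (\<open>purification_if_no_conformal_pair\<close>). Call \<open>A\<close> good if there is no
  such plane.

  The good matrices form an open set: bad ones are the projection of a closed set along the
  compact set of pairs of unit vectors (\<open>open_no_conformal_pair\<close>). They are also dense. If \<open>A\<close>
  has a basis of eigenvectors whose eigenvalues have pairwise distinct moduli, then any plane
  contains two vectors with different growth rates under \<open>A\<^sup>n\<close>, so \<open>A\<close> is good
  (\<open>full_eigensystem_no_conformal_pair\<close>). Such an \<open>A\<close> exists arbitrarily close to any given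
  matrix: eigenvectors are collected one at a time, each time finding an eigenvector modulo the
  span of those already found, and moving its eigenvalue slightly to a new modulus
  (\<open>extend_eigensystem\<close>).

  Finally, evaluation at \<open>x\<close> is continuous, and adding a small constant map to \<open>L\<close> moves \<open>L x\<close>
  to any nearby matrix. Hence the maps \<open>L\<close> with \<open>L x\<close> good form a single open dense set of
  purifying maps.\<close>

section \<open>Planes on which all powers act as scaled isometries\<close>

lemma norm_vector_scalar_mult: "norm (a *s x) = cmod a * norm (x :: complex^'k)"
  by (simp add: norm_vec_def L2_set_def norm_mult power_mult_distrib
      flip: sum_distrib_left) (simp add: real_sqrt_mult)

lemma continuous_on_vector_scalar_mult [continuous_intros]:
  fixes f :: "'a::topological_space \<Rightarrow> complex" and g :: "'a \<Rightarrow> complex^'k"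
  assumes "continuous_on S f" "continuous_on S g"
  shows "continuous_on S (\<lambda>z. f z *s g z)"
  unfolding vector_scalar_mult_def by (intro continuous_intros assms)

lemma continuous_on_matrix_vector_mult [continuous_intros]:
  fixes f :: "'a::topological_space \<Rightarrow> complex^'n^'m"
  assumes "continuous_on S f" "continuous_on S g"
  shows "continuous_on S (\<lambda>z. f z *v g z)"
  unfolding matrix_vector_mult_def by (intro continuous_intros assms)

lemma continuous_on_matrix_iterate [continuous_intros]:
  fixes f :: "'a::topological_space \<Rightarrow> complex^'k^'k"
  assumes "continuous_on S f" "continuous_on S g"
  shows "continuous_on S (\<lambda>z. ((*v) (f z) ^^ n) (g z))"
  by (induction n) (auto intro!: continuous_intros assms)

text \<open>A normalized basis of a plane on which all powers of \<open>A\<close> are scaled isometries. Linear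
  independence is expressed by distance at least one from the line through \<open>v\<close>: unlike
  independence itself, this is a closed condition, which makes the set of admissible pairs
  compact. The \<open>n\<close>-th power scales by the length that it gives to the unit vector \<open>v\<close>.\<close>

definition conformal_pair :: "complex^'k^'k \<Rightarrow> complex^'k \<Rightarrow> complex^'k \<Rightarrow> bool" where
  "conformal_pair A u v \<longleftrightarrow>
     norm u = 1 \<and> norm v = 1 \<and> (\<forall>a. 1 \<le> norm (u - a *s v)) \<and>
     (\<forall>n a b. norm (((*v) A ^^ n) (a *s u + b *s v))
        = norm (((*v) A ^^ n) v) * norm (a *s u + b *s v))"

text \<open>The defining conditions are closed jointly in \<open>A\<close>, \<open>u\<close> and \<open>v\<close>, and the projection of a closed
  set along a compact factor is closed.\<close>

lemma open_no_conformal_pair: "open {A :: complex^'k^'k. \<nexists>u v. conformal_pair A u v}"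
proof -
  let ?S = "sphere 0 1 \<times> sphere 0 1 :: ((complex^'k) \<times> (complex^'k)) set"
  let ?T = "{p :: ((complex^'k) \<times> (complex^'k)) \<times> (complex^'k^'k).
     (\<forall>a. 1 \<le> norm (fst (fst p) - a *s snd (fst p))) \<and>
     (\<forall>n a b. norm (((*v) (snd p) ^^ n) (a *s fst (fst p) + b *s snd (fst p)))
       = norm (((*v) (snd p) ^^ n) (snd (fst p))) * norm (a *s fst (fst p) + b *s snd (fst p)))}"
  have "closed ?T"
    by (intro closed_Collect_conj closed_Collect_all closed_Collect_le closed_Collect_eq
        continuous_intros)
  then have "closed {A. \<exists>p. p \<in> ?S \<and> (p, A) \<in> ?T}"
    by (intro closed_compact_projection compact_Times compact_sphere)
  moreover have "{A. \<exists>p. p \<in> ?S \<and> (p, A) \<in> ?T} = {A. \<exists>u v. conformal_pair A u v}"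
    by (auto simp: conformal_pair_def)
  ultimately have "closed {A :: complex^'k^'k. \<exists>u v. conformal_pair A u v}" by (simp only:)
  then have "open (- {A :: complex^'k^'k. \<exists>u v. conformal_pair A u v})" by (rule open_Compl)
  also have "- {A :: complex^'k^'k. \<exists>u v. conformal_pair A u v}
      = {A. \<nexists>u v. conformal_pair A u v}" by blast
  finally show ?thesis .
qed

text \<open>Any basis of such a plane can be normalized: scale \<open>v\<close> to length one, subtract from \<open>u\<close> its
  nearest point on the line through \<open>v\<close>, and scale the difference to length one.\<close>

lemma conformal_pair_if_independent:
  fixes A :: "complex^'k^'k"
  assumes "v \<noteq> 0" and "u \<notin> vec.span {v}"
    and iso: "\<And>n. \<exists>c. \<forall>a b. norm (((*v) A ^^ n) (a *s u + b *s v)) = c * norm (a *s u + b *s v)"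
  shows "\<exists>u' v'. conformal_pair A u' v'"
proof -
  let ?r = "complex_of_real"
  define v' where "v' = ?r (1 / norm v) *s v"
  have nv': "norm v' = 1"
    using assms(1) by (simp add: v'_def norm_vector_scalar_mult norm_divide)
  define M where "M = range (\<lambda>a::complex. a *s v')"
  have "subspace M"
    unfolding M_def subspace_def
  proof (intro conjI ballI allI)
    show "0 \<in> range (\<lambda>a::complex. a *s v')" by (rule image_eqI[of _ _ 0]) auto
  next
    fix x y assume "x \<in> range (\<lambda>a::complex. a *s v')" "y \<in> range (\<lambda>a::complex. a *s v')"
    then obtain a b where "x = a *s v'" "y = b *s v'" by auto
    then have "x + y = (a + b) *s v'" by (simp add: vec.scale_left_distrib)
    then show "x + y \<in> range (\<lambda>a::complex. a *s v')" by blast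
  next
    fix c x assume "x \<in> range (\<lambda>a::complex. a *s v')"
    then obtain a where "x = a *s v'" by auto
    then have "c *\<^sub>R x = (?r c * a) *s v'"
      by (simp add: vec_eq_iff) (simp add: scaleR_conv_of_real mult.assoc)
    then show "c *\<^sub>R x \<in> range (\<lambda>a::complex. a *s v')" by blast
  qed
  then have "closed M" by (rule closed_subspace)
  moreover have "M \<noteq> {}" by (auto simp: M_def)
  ultimately obtain m where "m \<in> M" and m: "\<And>y. y \<in> M \<Longrightarrow> dist u m \<le> dist u y"
    by (metis distance_attains_inf)
  then obtain a0 where a0: "m = a0 *s v'" by (auto simp: M_def)
  define d where "d = norm (u - a0 *s v')"
  have dmin: "d \<le> norm (u - a *s v')" for a
    using m[of "a *s v'"] unfolding a0 d_def M_def dist_norm by blast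
  have "d \<noteq> 0"
  proof
    assume "d = 0"
    then have "u = (a0 * ?r (1 / norm v)) *s v" by (simp add: d_def v'_def)
    then show False using assms(2) by (auto intro: vec.span_scale vec.span_base)
  qed
  then have "d > 0" by (simp add: d_def)
  define u' where "u' = ?r (1 / d) *s (u - a0 *s v')"
  have nu': "norm u' = 1"
    unfolding u'_def norm_vector_scalar_mult d_def[symmetric] using \<open>d > 0\<close> by (simp add: norm_divide)
  have far: "1 \<le> norm (u' - a *s v')" for a
  proof -
    have "u' - a *s v' = ?r (1 / d) *s (u - (a0 + ?r d * a) *s v')"
      using \<open>d > 0\<close> by (simp add: u'_def vec_eq_iff field_simps)
    then have "norm (u' - a *s v') = norm (u - (a0 + ?r d * a) *s v') / d"
      using \<open>d > 0\<close> by (simp only: norm_vector_scalar_mult) (simp add: norm_divide)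
    then show ?thesis using dmin[of "a0 + ?r d * a"] \<open>d > 0\<close> by simp
  qed
  have "norm (((*v) A ^^ n) (a *s u' + b *s v'))
      = norm (((*v) A ^^ n) v') * norm (a *s u' + b *s v')" for n a b
  proof -
    obtain c where c: "\<And>a b. norm (((*v) A ^^ n) (a *s u + b *s v)) = c * norm (a *s u + b *s v)"
      using iso by blast
    have 1: "a *s u' + b *s v'
        = (a * ?r (1/d)) *s u + ((b - a * ?r (1/d) * a0) * ?r (1 / norm v)) *s v" for a b
      by (simp add: u'_def v'_def vec_eq_iff algebra_simps)
    have 2: "norm (((*v) A ^^ n) (a *s u' + b *s v')) = c * norm (a *s u' + b *s v')" for a b
      unfolding 1 by (rule c)
    have "norm (((*v) A ^^ n) v') = c"
      using 2[of 0 1] nv' by simp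
    with 2 show ?thesis by simp
  qed
  then show ?thesis
    using nu' nv' far unfolding conformal_pair_def by blast
qed

section \<open>Eigenvectors with eigenvalues of distinct moduli\<close>

definition eigensystem :: "complex^'k^'k \<Rightarrow> (complex^'k) set \<Rightarrow> (complex^'k \<Rightarrow> complex) \<Rightarrow> bool" where
  "eigensystem A B l \<longleftrightarrow>
     vec.independent B \<and> (\<forall>b\<in>B. A *v b = l b *s b) \<and> inj_on (\<lambda>b. cmod (l b)) B"

lemma linear_matrix_iterate: "Vector_Spaces.linear (*s) (*s) ((*v) (A :: complex^'k^'k) ^^ n)"
proof (induction n)
  case 0
  then show ?case using vec.linear_id by (simp add: id_def)
next
  case (Suc n)
  show ?case
    using Vector_Spaces.linear_compose[OF Suc matrix_vector_mul_linear_gen[of A]] by (simp add: o_def)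
qed

lemma matrix_iterate_eigenvector:
  assumes "A *v b = r *s b"
  shows "((*v) (A :: complex^'k^'k) ^^ n) b = r ^ n *s b"
  by (induction n) (simp_all add: assms vector_scalar_commute mult.commute)

text \<open>Expand \<open>u\<close> and \<open>v\<close> in the eigenbasis and let \<open>b\<close> be the eigenvector of largest eigenvalue modulus
  that occurs in either expansion. Some nonzero combination \<open>w\<close> of \<open>u\<close> and \<open>v\<close> has no
  \<open>b\<close>-component, while another combination \<open>z\<close> has one. The moduli are distinct, so \<open>A\<^sup>n w\<close>
  becomes negligible compared with \<open>A\<^sup>n z\<close>, although scaled isometries preserve the ratio of
  the two norms.\<close>

lemma full_eigensystem_no_conformal_pair:
  fixes A :: "complex^'k^'k"
  assumes sys: "eigensystem A B l" and card: "card B = CARD('k)"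
  shows "\<not> conformal_pair A u v"
proof
  assume uv: "conformal_pair A u v"
  have ind: "vec.independent B" and ev: "\<And>b. b \<in> B \<Longrightarrow> A *v b = l b *s b"
    and inj: "inj_on (\<lambda>b. cmod (l b)) B"
    using sys by (auto simp: eigensystem_def)
  have fin: "finite B" using ind by (rule vec.finiteI_independent)
  have "vec.span B = UNIV"
    using ind card vec.card_ge_dim_independent[of B UNIV] by (simp only: vec_dim_card) auto
  then have ex: "\<exists>g. x = (\<Sum>c\<in>B. g c *s c)" for x
    using vec.span_finite[OF fin] by auto
  obtain g where g: "u = (\<Sum>c\<in>B. g c *s c)" using ex by blast
  obtain h where h: "v = (\<Sum>c\<in>B. h c *s c)" using ex by blast
  have pow: "((*v) A ^^ n) (\<Sum>c\<in>B. f c *s c) = (\<Sum>c\<in>B. (f c * l c ^ n) *s c)" for f n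
    by (simp add: vec.linear_sum[OF linear_matrix_iterate] vec.linear_scale[OF linear_matrix_iterate]
        matrix_iterate_eigenvector[OF ev] cong: sum.cong)
  define Q where "Q = {c \<in> B. g c \<noteq> 0 \<or> h c \<noteq> 0}"
  have "Q \<noteq> {}"
  proof
    assume "Q = {}"
    then have "v = 0" unfolding h by (intro sum.neutral) (auto simp: Q_def)
    then show False using uv by (auto simp: conformal_pair_def)
  qed
  moreover have "finite Q" using fin by (simp add: Q_def)
  ultimately obtain b where "b \<in> Q" and bmax: "\<And>c. c \<in> Q \<Longrightarrow> cmod (l c) \<le> cmod (l b)"
    using ex_is_arg_min_if_finite[of Q "\<lambda>c. - cmod (l c)"] by (auto simp: is_arg_min_def not_less)
  then have bB: "b \<in> B" and gh: "g b \<noteq> 0 \<or> h b \<noteq> 0" by (auto simp: Q_def)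
  \<comment> \<open>In these coefficients \<open>w\<close> has \<open>b\<close>-component \<open>0\<close> and \<open>z\<close> has \<open>b\<close>-component
    \<open>\<bar>g b\<bar>\<^sup>2 + \<bar>h b\<bar>\<^sup>2\<close>, which is positive whichever of the two coefficients is nonzero.\<close>
  define w where "w = h b *s u + (- g b) *s v"
  define z where "z = cnj (g b) *s u + cnj (h b) *s v"
  define fw where "fw c = h b * g c - g b * h c" for c
  define fz where "fz c = cnj (g b) * g c + cnj (h b) * h c" for c
  have w: "w = (\<Sum>c\<in>B. fw c *s c)"
    unfolding w_def g h fw_def
    by (simp add: vec.scale_sum_right vec.scale_left_diff_distrib sum_subtractf vec.scale_minus_left sum_negf)
  have z: "z = (\<Sum>c\<in>B. fz c *s c)"
    unfolding z_def g h fz_def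
    by (simp add: vec.scale_sum_right vec.scale_left_distrib sum.distrib)
  have fzb: "fz b \<noteq> 0"
  proof -
    have "fz b = complex_of_real ((cmod (g b))\<^sup>2 + (cmod (h b))\<^sup>2)"
      by (simp add: fz_def complex_norm_square mult.commute del: of_real_power)
    moreover have "(cmod (g b))\<^sup>2 + (cmod (h b))\<^sup>2 > 0"
      using gh by (simp add: sum_power2_gt_zero_iff)
    ultimately show ?thesis by (metis less_irrefl of_real_eq_0_iff)
  qed
  have "w \<noteq> 0"
  proof (cases "h b = 0")
    case True
    then show ?thesis using gh uv by (auto simp: w_def conformal_pair_def)
  next
    case False
    then have "w = h b *s (u - (g b / h b) *s v)"
      by (simp add: w_def vec_eq_iff field_simps)
    then have "norm w = cmod (h b) * norm (u - (g b / h b) *s v)"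
      by (simp only: norm_vector_scalar_mult)
    moreover have "norm (u - (g b / h b) *s v) \<ge> 1"
      using uv by (auto simp: conformal_pair_def)
    ultimately show ?thesis using False by auto
  qed
  define T where "T = {c \<in> B. fw c \<noteq> 0}"
  have T_less: "cmod (l c) < cmod (l b)" if "c \<in> T" for c
  proof -
    have "c \<in> Q" "c \<in> B" "c \<noteq> b" using that by (auto simp: T_def Q_def fw_def)
    then show ?thesis
      using bmax[of c] inj bB by (metis inj_onD order_le_imp_less_or_eq)
  qed
  have "T \<noteq> {}"
  proof
    assume "T = {}"
    then have "w = 0" unfolding w by (intro sum.neutral) (auto simp: T_def)
    with \<open>w \<noteq> 0\<close> show False by simp
  qed
  then have lb: "cmod (l b) > 0" using T_less by (meson all_not_in_conv norm_ge_zero order_le_less_trans)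
  have ratio: "norm (((*v) A ^^ n) w) * norm z = norm (((*v) A ^^ n) z) * norm w" for n
  proof -
    have iso: "norm (((*v) A ^^ n) (a *s u + b *s v)) = norm (((*v) A ^^ n) v) * norm (a *s u + b *s v)"
      for a b using uv by (auto simp: conformal_pair_def)
    show ?thesis unfolding w_def z_def iso by (simp only: mult_ac)
  qed
  have upper: "norm (((*v) A ^^ n) w) \<le> (\<Sum>c\<in>T. cmod (fw c) * norm c * cmod (l c) ^ n)" for n
  proof -
    have "((*v) A ^^ n) w = (\<Sum>c\<in>T. (fw c * l c ^ n) *s c)"
      unfolding w pow by (rule sum.mono_neutral_right) (auto simp: fin T_def)
    also have "norm \<dots> \<le> (\<Sum>c\<in>T. norm ((fw c * l c ^ n) *s c))" by (rule norm_sum)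
    finally show ?thesis
      by (simp add: norm_vector_scalar_mult norm_mult norm_power mult_ac)
  qed
  \<comment> \<open>The projection onto the \<open>b\<close>-component is bounded, so the \<open>b\<close>-component of \<open>A\<^sup>n z\<close> bounds its
    norm from below.\<close>
  obtain F where F: "Vector_Spaces.linear (*s) (*s) F" "\<And>c. c \<in> B \<Longrightarrow> F c = (if c = b then b else 0)"
    using vec.linear_independent_extend[OF ind, of "\<lambda>c. if c = b then b else 0"] by blast
  have "linear F"
    using matrix_vector_mul_linear[of "matrix F"] matrix_works[OF F(1)] by simp
  then obtain K where "K > 0" and K: "\<And>x. norm (F x) \<le> K * norm x"
    using linear_bounded_pos by blast
  have lower: "cmod (fz b) * norm b * cmod (l b) ^ n \<le> K * norm (((*v) A ^^ n) z)" for n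
  proof -
    have "F (((*v) A ^^ n) z) = (\<Sum>c\<in>B. (fz c * l c ^ n) *s F c)"
      unfolding z pow by (simp add: vec.linear_sum[OF F(1)] vec.linear_scale[OF F(1)])
    also have "\<dots> = (\<Sum>c\<in>B. if c = b then (fz b * l b ^ n) *s b else 0)"
      by (intro sum.cong) (auto simp: F(2))
    also have "\<dots> = (fz b * l b ^ n) *s b" using fin bB by simp
    finally show ?thesis
      using K[of "((*v) A ^^ n) z"] by (simp add: norm_vector_scalar_mult norm_mult norm_power mult_ac)
  qed
  define D where "D = cmod (fz b) * norm b * norm w"
  have "b \<noteq> 0" using ind bB vec.dependent_zero by blast
  then have "D > 0" using fzb \<open>w \<noteq> 0\<close> by (simp add: D_def)
  \<comment> \<open>Compare both growth rates and divide by \<open>\<bar>l b\<bar>\<^sup>n\<close>; the right-hand side tends to \<open>0\<close>.\<close>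
  have bound: "D \<le> K * norm z * (\<Sum>c\<in>T. cmod (fw c) * norm c * (cmod (l c) / cmod (l b)) ^ n)" for n
  proof -
    have "D * cmod (l b) ^ n \<le> K * norm (((*v) A ^^ n) z) * norm w"
      using mult_right_mono[OF lower[of n] norm_ge_zero[of w]] by (simp add: D_def mult_ac)
    also have "\<dots> = K * norm z * norm (((*v) A ^^ n) w)"
      using ratio[of n] by (simp add: mult_ac)
    also have "\<dots> \<le> K * norm z * (\<Sum>c\<in>T. cmod (fw c) * norm c * cmod (l c) ^ n)"
      using upper \<open>K > 0\<close> by (intro mult_left_mono) auto
    finally have "D \<le> K * norm z * (\<Sum>c\<in>T. cmod (fw c) * norm c * cmod (l c) ^ n) / cmod (l b) ^ n"
      using lb by (simp add: pos_le_divide_eq)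
    then show ?thesis by (simp add: sum_divide_distrib power_divide flip: times_divide_eq_right)
  qed
  have "(\<lambda>n. K * norm z * (\<Sum>c\<in>T. cmod (fw c) * norm c * (cmod (l c) / cmod (l b)) ^ n))
      \<longlonglongrightarrow> K * norm z * (\<Sum>c\<in>T. cmod (fw c) * norm c * 0)"
    by (intro tendsto_intros LIMSEQ_realpow_zero) (use T_less lb in auto)
  then have "D \<le> K * norm z * (\<Sum>c\<in>T. cmod (fw c) * norm c * 0)"
    by (rule LIMSEQ_le_const) (use bound in blast)
  then show False using \<open>D > 0\<close> by simp
qed

section \<open>Density of the matrices with a full system\<close>

text \<open>The vector \<open>p(A) w\<close>, computed by the Horner scheme.\<close>

definition poly_act :: "complex^'k^'k \<Rightarrow> complex^'k \<Rightarrow> complex poly \<Rightarrow> complex^'k" where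
  "poly_act A w p = fold_coeffs (\<lambda>c y. c *s w + A *v y) p 0"

lemma poly_act_0 [simp]: "poly_act A w 0 = 0"
  by (simp add: poly_act_def)

lemma poly_act_pCons [simp]: "poly_act A w (pCons c p) = c *s w + A *v poly_act A w p"
  by (cases "c = 0 \<and> p = 0") (auto simp: poly_act_def)

lemma poly_act_add: "poly_act A w (p + q) = poly_act A w p + poly_act A w q"
  by (induction p q rule: poly_induct2)
    (simp_all add: vec.scale_left_distrib matrix_vector_right_distrib)

lemma poly_act_smult: "poly_act A w (smult c p) = c *s poly_act A w p"
  by (induction p) (simp_all add: vec.scale_right_distrib vector_scalar_commute)

lemma poly_act_diff: "poly_act A w (p - q) = poly_act A w p - poly_act A w q"
  using poly_act_add[of A w p "- q"] poly_act_smult[of A w "-1" q] by simp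

lemma poly_act_monom: "poly_act A w (monom 1 n) = ((*v) A ^^ n) w"
  by (induction n) (simp_all add: monom_0 monom_Suc)

text \<open>The iterates \<open>w, A w, A\<^sup>2 w, \<dots>\<close> cannot all be linearly independent, so one of them is a
  combination of its predecessors.\<close>

lemma exists_annihilating_poly: "\<exists>p. p \<noteq> 0 \<and> poly_act A (w :: complex^'k) p = 0"
proof -
  let ?x = "\<lambda>i. ((*v) A ^^ i) w"
  have "\<exists>n. ?x n \<in> vec.span (?x ` {..<n})"
  proof (rule ccontr)
    assume *: "\<nexists>n. ?x n \<in> vec.span (?x ` {..<n})"
    have "vec.independent (?x ` {..<n}) \<and> card (?x ` {..<n}) = n" for n
    proof (induction n)
      case (Suc n)
      have "?x n \<notin> vec.span (?x ` {..<n})" using * by blast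
      moreover from this have "?x n \<notin> ?x ` {..<n}" using vec.span_base[of "?x n"] by metis
      moreover have "?x ` {..<Suc n} = insert (?x n) (?x ` {..<n})"
        by (simp only: lessThan_Suc image_insert)
      ultimately show ?case
        using Suc vec.independent_insertI[of "?x n" "?x ` {..<n}"]
          card_insert_disjoint[of "?x ` {..<n}" "?x n"] by (metis finite_imageI finite_lessThan)
    qed (auto simp: vec.independent_empty)
    from this[of "Suc CARD('k)"] have "Suc CARD('k) \<le> vec.dim (UNIV :: (complex^'k) set)"
      using vec.independent_card_le_dim[OF subset_UNIV] by metis
    then show False by (simp only: vec_dim_card)
  qed
  then obtain n where n: "?x n \<in> vec.span (?x ` {..<n})" by blast
  have "\<exists>q. poly_act A w q = y \<and> (\<forall>i\<ge>n. coeff q i = 0)" if "y \<in> vec.span (?x ` {..<n})" for y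
    using that
  proof (induction rule: vec.span_induct_alt)
    case base
    show ?case by (rule exI[of _ 0]) simp
  next
    case (step c x y)
    then obtain i q where "i < n" "x = ?x i" "poly_act A w q = y" "\<forall>i\<ge>n. coeff q i = 0" by auto
    then show ?case
      by (intro exI[of _ "smult c (monom 1 i) + q"])
        (auto simp: poly_act_add poly_act_smult poly_act_monom)
  qed
  with n obtain q where q: "poly_act A w q = ?x n" "\<forall>i\<ge>n. coeff q i = 0" by blast
  let ?p = "monom 1 n + smult (-1) q"
  have "coeff ?p n = 1" using q(2) by simp
  then have "?p \<noteq> 0" by (metis coeff_0 zero_neq_one)
  moreover have "poly_act A w ?p = 0"
    by (simp only: poly_act_add poly_act_smult poly_act_monom q(1)) simp
  ultimately show ?thesis by blast
qed

text \<open>Take \<open>w\<close> outside \<open>S\<close> and a nonzero \<open>p\<close> of least degree with \<open>p(A) w \<in> S\<close>. Splitting off a root,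
  \<open>p = (X - r) q\<close>, minimality puts \<open>b = q(A) w\<close> outside \<open>S\<close>, while \<open>(A - r) b = p(A) w\<close> lies
  in \<open>S\<close>.\<close>

lemma eigenvector_modulo_subspace:
  fixes A :: "complex^'k^'k"
  assumes S: "vec.subspace S" and "S \<noteq> UNIV"
  obtains b r where "b \<notin> S" "A *v b - r *s b \<in> S"
proof -
  obtain w where w: "w \<notin> S" using \<open>S \<noteq> UNIV\<close> by auto
  let ?P = "\<lambda>p. p \<noteq> 0 \<and> poly_act A w p \<in> S"
  obtain p0 where "?P p0"
    using exists_annihilating_poly[of A w] vec.subspace_0[OF S] by metis
  then obtain p where p: "?P p" and min: "\<And>q. ?P q \<Longrightarrow> degree p \<le> degree q"
    using ex_has_least_nat[of ?P p0 degree] by blast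
  have "degree p \<noteq> 0"
  proof
    assume "degree p = 0"
    then obtain c where c: "p = [:c:]" by (rule degree_eq_zeroE)
    with p have "c \<noteq> 0" "c *s w \<in> S" by auto
    then have "inverse c *s (c *s w) \<in> S" using vec.subspace_scale[OF S] by blast
    with \<open>c \<noteq> 0\<close> w show False by simp
  qed
  then have "\<not> constant (poly p)" by (simp add: constant_degree)
  then obtain r where "poly p r = 0" using fundamental_theorem_of_algebra by blast
  then obtain q where q: "p = [:-r, 1:] * q" by (auto simp: poly_eq_0_iff_dvd dvd_def)
  with p have "q \<noteq> 0" by auto
  then have "degree p = Suc (degree q)" unfolding q by (subst degree_mult_eq) auto
  with min[of q] \<open>q \<noteq> 0\<close> have "poly_act A w q \<notin> S" by auto
  moreover have "poly_act A w p = A *v poly_act A w q - r *s poly_act A w q"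
    unfolding q by (simp add: poly_act_diff poly_act_smult)
  ultimately show ?thesis using that p by metis
qed

text \<open>Let \<open>b\<close> be an eigenvector modulo the span of \<open>B\<close>. Adding a small multiple of a map that kills \<open>B\<close>
  and rescales \<open>b\<close> keeps the old eigenvectors and moves the new eigenvalue to a modulus not yet
  used. Since the new eigenvalue differs from the old ones, \<open>b\<close> can be corrected by a vector of
  the span to become a genuine eigenvector.\<close>

lemma extend_eigensystem:
  fixes A :: "complex^'k^'k"
  assumes sys: "eigensystem A B l" and card: "card B < CARD('k)" and "e > 0"
  shows "\<exists>A' B' l'. norm (A' - A) < e \<and> eigensystem A' B' l' \<and> card B' = Suc (card B)"
proof -
  have ind: "vec.independent B" and ev: "\<And>b. b \<in> B \<Longrightarrow> A *v b = l b *s b"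
    and inj: "inj_on (\<lambda>b. cmod (l b)) B"
    using sys by (auto simp: eigensystem_def)
  have fin: "finite B" using ind by (rule vec.finiteI_independent)
  have "vec.span B \<noteq> UNIV"
    using card vec.dim_eq_card_independent[OF ind] vec.dim_span[of B] 
    by (metis less_irrefl vec_dim_card)
  then obtain b r where b: "b \<notin> vec.span B" and br: "A *v b - r *s b \<in> vec.span B"
    using eigenvector_modulo_subspace vec.subspace_span by blast
  \<comment> \<open>Moving \<open>r\<close> radially by \<open>t\<close> increases its modulus by exactly \<open>t\<close>.\<close>
  define \<sigma> where "\<sigma> = (if r = 0 then 1 else sgn r)"
  have \<sigma>: "cmod (r + complex_of_real t * \<sigma>) = cmod r + t" if "t > 0" for t
  proof (cases "r = 0")
    case False
    then have "r + complex_of_real t * \<sigma> = complex_of_real (cmod r + t) * sgn r"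
      by (simp add: \<sigma>_def sgn_eq field_simps)
    then show ?thesis using that False
      by (simp only: norm_mult norm_of_real norm_sgn) simp
  qed (use that in \<open>simp add: \<sigma>_def\<close>)
  have ind': "vec.independent (insert b B)" using ind b by (rule vec.independent_insertI[rotated])
  obtain F where F: "Vector_Spaces.linear (*s) (*s) F"
      "\<And>c. c \<in> insert b B \<Longrightarrow> F c = (if c = b then \<sigma> *s b else 0)"
    using vec.linear_independent_extend[OF ind', of "\<lambda>c. if c = b then \<sigma> *s b else 0"] by blast
  define P where "P = matrix F"
  have "b \<notin> B" using b vec.span_base by blast
  then have Pb: "P *v b = \<sigma> *s b" and Pc: "\<And>c. c \<in> B \<Longrightarrow> P *v c = 0"
    unfolding P_def using matrix_works[OF F(1)] F(2) by auto
  have "infinite {0<..<e / (norm P + 1)}"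
    using \<open>e > 0\<close> by (intro infinite_Ioo divide_pos_pos) (auto intro: add_nonneg_pos)
  then have "\<not> {0<..<e / (norm P + 1)} \<subseteq> (\<lambda>c. cmod (l c) - cmod r) ` B"
    using fin finite_subset by blast
  then obtain t where t: "0 < t" "t < e / (norm P + 1)"
      and avoid: "\<And>c. c \<in> B \<Longrightarrow> cmod (l c) \<noteq> cmod r + t"
    by (fastforce simp: subset_iff image_iff)
  define \<mu> where "\<mu> = r + complex_of_real t * \<sigma>"
  have \<mu>: "cmod (l c) \<noteq> cmod \<mu>" if "c \<in> B" for c
    using avoid[OF that] \<sigma>[OF t(1)] by (simp add: \<mu>_def)
  define A' where "A' = A + t *\<^sub>R P"
  have "norm (A' - A) < e"
  proof -
    have "norm (A' - A) = t * norm P" using t by (simp add: A'_def)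
    also have "\<dots> \<le> t * (norm P + 1)" using t by simp
    also have "\<dots> < e" using t(2) norm_ge_zero[of P] by (simp add: pos_less_divide_eq add_nonneg_pos)
    finally show ?thesis .
  qed
  have A': "A' *v x = A *v x + t *\<^sub>R (P *v x)" for x
    by (simp add: A'_def matrix_vector_mult_add_rdistrib)
      (simp add: matrix_vector_mult_def vec_eq_iff scaleR_sum_right)
  have A'c: "A' *v c = l c *s c" if "c \<in> B" for c
    using that by (simp add: A' Pc ev)
  obtain g where g: "A *v b - r *s b = (\<Sum>c\<in>B. g c *s c)"
    using br vec.span_finite[OF fin] by auto
  have tP: "t *\<^sub>R (P *v b) = (complex_of_real t * \<sigma>) *s b"
    unfolding Pb by (simp add: vec_eq_iff scaleR_conv_of_real[where 'a=complex] mult.assoc)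
  have A'b: "A' *v b = \<mu> *s b + (\<Sum>c\<in>B. g c *s c)"
    unfolding A' tP g[symmetric] \<mu>_def by (simp add: vec.scale_left_distrib)
  \<comment> \<open>The coefficients of \<open>y\<close> solve \<open>g c + l c * x = \<mu> * x\<close>, that is, \<open>(A' - \<mu>) (b + y) = 0\<close>.\<close>
  define y where "y = (\<Sum>c\<in>B. (g c / (\<mu> - l c)) *s c)"
  define v where "v = b + y"
  have "y \<in> vec.span B" unfolding y_def by (intro vec.span_sum vec.span_scale vec.span_base)
  then have v: "v \<notin> vec.span B"
    using b vec.span_diff[of v B y] by (auto simp: v_def)
  have "(\<Sum>c\<in>B. g c *s c) + A' *v y = \<mu> *s y"
  proof -
    have "A' *v y = (\<Sum>c\<in>B. (g c / (\<mu> - l c) * l c) *s c)"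
      unfolding y_def
      by (simp add: vec.linear_sum[OF matrix_vector_mul_linear_gen[of A']] vector_scalar_commute A'c
          cong: sum.cong)
    then have "(\<Sum>c\<in>B. g c *s c) + A' *v y = (\<Sum>c\<in>B. (g c + g c / (\<mu> - l c) * l c) *s c)"
      by (simp add: vec.scale_left_distrib sum.distrib)
    also have "\<dots> = (\<Sum>c\<in>B. (\<mu> * (g c / (\<mu> - l c))) *s c)"
    proof (intro sum.cong refl arg_cong2[where f = "(*s)"])
      fix c assume "c \<in> B"
      then have "\<mu> - l c \<noteq> 0" using \<mu> by auto
      then show "g c + g c / (\<mu> - l c) * l c = \<mu> * (g c / (\<mu> - l c))" by (simp add: field_simps)
    qed
    finally show ?thesis by (simp add: y_def vec.scale_sum_right)
  qed
  then have A'v: "A' *v v = \<mu> *s v"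
    by (simp add: v_def matrix_vector_right_distrib A'b vec.scale_right_distrib add.assoc)
  have "v \<notin> B" using v vec.span_base by blast
  have "eigensystem A' (insert v B) (l(v := \<mu>))"
    unfolding eigensystem_def
  proof (intro conjI)
    show "vec.independent (insert v B)" using ind v by (rule vec.independent_insertI[rotated])
    show "\<forall>c\<in>insert v B. A' *v c = (l(v := \<mu>)) c *s c" using A'v A'c \<open>v \<notin> B\<close> by auto
    show "inj_on (\<lambda>c. cmod ((l(v := \<mu>)) c)) (insert v B)"
      using inj \<mu> \<open>v \<notin> B\<close> by (auto simp: inj_on_def) metis+
  qed
  moreover have "card (insert v B) = Suc (card B)" using fin \<open>v \<notin> B\<close> by simp
  ultimately show ?thesis using \<open>norm (A' - A) < e\<close> by blast
qed

lemma approximate_by_eigensystem: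
  fixes A :: "complex^'k^'k"
  assumes "j \<le> CARD('k)" "e > 0"
  shows "\<exists>A' B l. norm (A' - A) < e \<and> eigensystem A' B l \<and> card B = j"
  using assms
proof (induction j arbitrary: e)
  case 0
  then show ?case
    by (intro exI[of _ A] exI[of _ "{}"] exI) (auto simp: eigensystem_def vec.independent_empty)
next
  case (Suc j)
  then obtain A1 B1 l1 where 1: "norm (A1 - A) < e / 2" "eigensystem A1 B1 l1" "card B1 = j"
    using Suc.IH[of "e / 2"] by auto
  obtain A2 B2 l2 where 2: "norm (A2 - A1) < e / 2" "eigensystem A2 B2 l2" "card B2 = Suc j"
    using extend_eigensystem[OF 1(2), of "e / 2"] 1(3) Suc.prems by auto
  have "norm (A2 - A) < e"
    using norm_triangle_ineq[of "A2 - A1" "A1 - A"] 1(1) 2(1) by simp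
  with 2 show ?case by blast
qed

lemma dense_no_conformal_pair:
  fixes A :: "complex^'k^'k"
  assumes "e > 0"
  shows "\<exists>A'. norm (A' - A) < e \<and> (\<nexists>u v. conformal_pair A' u v)"
  using approximate_by_eigensystem[OF order_refl assms] full_eigensystem_no_conformal_pair by blast

section \<open>Projectors violating purification\<close>

text \<open>If the point were outside \<open>C\<close>, so would be a whole box around it, whose product measure is the
  product of positive measures of neighbourhoods of \<open>x\<close>. The restricted constant function is used
  because the elements of the product space take the default value outside the index set.\<close>

lemma AE_PiM_closed_at_support:
  fixes \<mu> :: "'a::topological_space measure" and n :: nat
  assumes sets: "sets \<mu> = sets borel" and sf: "sigma_finite_measure \<mu>"
    and x: "x \<in> measure_support \<mu>"
    and C: "closed C" and ae: "AE \<omega> in (\<Pi>\<^sub>M i\<in>{1..n}. \<mu>). \<omega> \<in> C"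
  shows "(\<lambda>i\<in>{1..n}. x) \<in> C"
proof (rule ccontr)
  interpret product_sigma_finite "\<lambda>_. \<mu>" using sf by (simp add: product_sigma_finite_def)
  let ?I = "{1..n}" and ?M = "\<Pi>\<^sub>M i\<in>{1..n}. \<mu>"
  let ?p = "\<lambda>i\<in>?I. x"
  assume "?p \<notin> C"
  then have "?p \<in> - C" by simp
  moreover have "openin (product_topology (\<lambda>i. euclidean) UNIV) (- C)"
    using C by (simp add: euclidean_product_topology open_Compl)
  ultimately obtain X where X: "?p \<in> (\<Pi>\<^sub>E i\<in>UNIV. X i)" "\<And>i. open (X i)" "(\<Pi>\<^sub>E i\<in>UNIV. X i) \<subseteq> - C"
    by (auto dest!: product_topology_open_contains_basis)
  let ?B = "\<Pi>\<^sub>E i\<in>?I. X i"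
  have B: "?B \<subseteq> - C"
  proof
    fix \<omega> assume \<omega>: "\<omega> \<in> ?B"
    have "\<omega> i \<in> X i" for i
    proof (cases "i \<in> ?I")
      case False
      then have "\<omega> i = ?p i" using PiE_arb[OF \<omega> False] by (simp only: restrict_apply False if_False)
      then show ?thesis using X(1) by (simp add: PiE_iff)
    qed (use \<omega> in auto)
    then show "\<omega> \<in> - C" using X(3) by (auto simp: PiE_iff subset_iff)
  qed
  obtain N where N: "{\<omega> \<in> space ?M. \<omega> \<notin> C} \<subseteq> N" "emeasure ?M N = 0" "N \<in> sets ?M"
    using ae by (rule AE_E)
  have XS: "X i \<in> sets \<mu>" for i using X(2) sets by simp
  have BM: "?B \<in> sets ?M" using XS by (intro sets_PiM_I_finite) auto
  have "?B \<subseteq> N" using B N(1) sets.sets_into_space[OF BM] by blast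
  then have "emeasure ?M ?B = 0" using N emeasure_eq_0 by blast
  moreover have "emeasure ?M ?B = (\<Prod>i\<in>?I. emeasure \<mu> (X i))"
    using XS by (intro emeasure_PiM) auto
  moreover have "emeasure \<mu> (X i) \<noteq> 0" if "i \<in> ?I" for i
  proof -
    have "x \<in> X i" using X(1) that by (auto simp: PiE_iff dest: spec[of _ i])
    then have "emeasure \<mu> (X i) > 0" using x X(2) by (auto simp: measure_support_def)
    then show ?thesis by simp
  qed
  ultimately show False by simp
qed

definition cinner :: "complex^'n \<Rightarrow> complex^'n \<Rightarrow> complex" where
  "cinner x y = (\<Sum>i\<in>UNIV. x $ i * cnj (y $ i))"

lemma cinner_self: "cinner x x = complex_of_real ((norm x)\<^sup>2)"
  by (simp add: cinner_def norm_vec_def L2_set_def sum_nonneg complex_norm_square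
      del: of_real_power)

lemma cinner_ctranspose: "cinner (M *v x) y = cinner x (ctranspose M *v y)"
proof -
  have "cinner (M *v x) y = (\<Sum>i\<in>UNIV. \<Sum>j\<in>UNIV. M $ i $ j * x $ j * cnj (y $ i))"
    by (simp add: cinner_def matrix_vector_mult_def sum_distrib_right)
  also have "\<dots> = (\<Sum>j\<in>UNIV. \<Sum>i\<in>UNIV. M $ i $ j * x $ j * cnj (y $ i))"
    by (rule sum.swap)
  finally show ?thesis
    by (simp add: cinner_def matrix_vector_mult_def ctranspose_def sum_distrib_left mult_ac)
qed

text \<open>For \<open>z\<close> in the range of \<open>P\<close>, the hermitian square of \<open>M z\<close> is the form of \<open>P M\<^sup>* M P\<close> at \<open>z\<close>,
  hence a fixed multiple of the hermitian square of \<open>z\<close>.\<close>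

lemma scaled_isometry_on_projector_range:
  fixes M P :: "complex^'k^'k"
  assumes P: "ctranspose P = P" and scal: "P ** ctranspose M ** M ** P \<propto> P"
  shows "\<exists>c. \<forall>z. P *v z = z \<longrightarrow> norm (M *v z) = c * norm z"
proof -
  obtain \<beta> where \<beta>: "P ** ctranspose M ** M ** P = (\<chi> i j. \<beta> * P $ i $ j)"
    using scal by (auto simp: prop_to_def)
  have sq: "complex_of_real ((norm (M *v z))\<^sup>2) = cnj \<beta> * complex_of_real ((norm z)\<^sup>2)"
    if z: "P *v z = z" for z
  proof -
    have "complex_of_real ((norm (M *v z))\<^sup>2) = cinner (M *v (P *v z)) (M *v (P *v z))"
      by (simp only: cinner_self z)
    also have "\<dots> = cinner z ((P ** ctranspose M ** M ** P) *v z)"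
      by (simp add: cinner_ctranspose P flip: matrix_vector_mul_assoc)
    also have "(P ** ctranspose M ** M ** P) *v z = \<beta> *s (P *v z)"
      unfolding \<beta> by (simp add: vec_eq_iff matrix_vector_mult_def sum_distrib_left mult.assoc)
    also have "cinner z (\<beta> *s (P *v z)) = cnj \<beta> * cinner z z"
      by (simp add: z cinner_def sum_distrib_left mult_ac)
    finally show ?thesis by (simp only: cinner_self)
  qed
  have "norm (M *v z) = sqrt (cmod \<beta>) * norm z" if "P *v z = z" for z
  proof -
    have "(norm (M *v z))\<^sup>2 = cmod \<beta> * (norm z)\<^sup>2"
      using arg_cong[OF sq[OF that], of cmod] by (simp add: norm_mult norm_power)
    then show ?thesis by (metis norm_ge_zero real_sqrt_mult real_sqrt_unique)
  qed
  then show ?thesis by blast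
qed

text \<open>The columns of \<open>P\<close> are fixed by \<open>P\<close>. The rank is defined through the rows, which for a
  self-adjoint matrix are the conjugates of the columns; if all columns lay on one line, so would
  all rows.\<close>

lemma projector_rank_one_or_plane:
  fixes P :: "complex^'k^'k"
  assumes P: "orthogonal_projector P" and "P \<noteq> 0" and "rank P \<noteq> 1"
  obtains u v where "P *v u = u" "P *v v = v" "v \<noteq> 0" "u \<notin> vec.span {v}"
proof -
  have PP: "P ** P = P" and herm: "ctranspose P = P"
    using P by (auto simp: orthogonal_projector_def)
  have fixed: "P *v column j P = column j P" for j
  proof -
    have "P *v column j P = column j (P ** P)"
      by (simp add: vec_eq_iff column_def matrix_vector_mult_def matrix_matrix_mult_def)
    then show ?thesis by (simp only: PP)
  qed
  obtain i j where ij: "P $ i $ j \<noteq> 0" using \<open>P \<noteq> 0\<close> by (auto simp: vec_eq_iff)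
  define v where "v = column j P"
  have "v \<noteq> 0" using ij by (auto simp: v_def column_def vec_eq_iff)
  have "\<exists>m. column m P \<notin> vec.span {v}"
  proof (rule ccontr)
    assume "\<nexists>m. column m P \<notin> vec.span {v}"
    then have "\<forall>m. \<exists>c. column m P = c *s v" by (auto simp: vec.span_singleton)
    then obtain c where c: "\<And>m. column m P = c m *s v" by metis
    define v' where "v' = (\<chi> l. cnj (v $ l))"
    have "row m P = cnj (c m) *s v'" for m
    proof -
      have "row m P $ l = cnj (column m P $ l)" for l
        using arg_cong[OF herm, of "\<lambda>Q. Q $ m $ l"] by (simp add: row_def column_def ctranspose_def)
      then show ?thesis by (simp add: vec_eq_iff c v'_def)
    qed
    then have "rows P \<subseteq> vec.span {v'}" by (auto simp: rows_def vec.span_singleton)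
    then have "vec.dim (rows P) \<le> card {v'}" by (rule vec.dim_le_card) simp
    moreover have "vec.dim (rows P) \<noteq> 0"
    proof
      assume "vec.dim (rows P) = 0"
      then have "row i P = 0" by (auto simp: vec.dim_eq_0 rows_def)
      with ij show False by (auto simp: row_def vec_eq_iff)
    qed
    ultimately show False using \<open>rank P \<noteq> 1\<close> by (simp add: row_rank_def_gen del: vec.dim_eq_0)
  qed
  then obtain m where "column m P \<notin> vec.span {v}" by blast
  then show ?thesis using that fixed \<open>v \<noteq> 0\<close> v_def by metis
qed

lemma continuous_on_W:
  assumes "continuous_on UNIV (L :: complex^'k^'k \<Rightarrow> complex^'k^'k)"
  shows "continuous_on UNIV (\<lambda>\<omega>. W L n \<omega> *v z)"
proof (induction n)
  case (Suc n)
  have "continuous_on UNIV (\<lambda>\<omega> :: nat \<Rightarrow> complex^'k^'k. L (\<omega> (Suc n)))"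
    by (rule continuous_on_compose2[OF assms continuous_on_product_coordinates]) simp
  then show ?case
    using continuous_on_matrix_vector_mult[OF _ Suc] by (simp flip: matrix_vector_mul_assoc)
qed simp

lemma W_constant: "(\<And>i. 1 \<le> i \<Longrightarrow> i \<le> n \<Longrightarrow> \<omega> i = x) \<Longrightarrow> W L n \<omega> *v z = ((*v) (L x) ^^ n) z"
  by (induction n) (simp_all flip: matrix_vector_mul_assoc)

text \<open>For two fixed vectors of the range, proportionality to the projector gives an equation between
  norms. This is a closed condition on \<open>\<omega>\<close>, so it can be evaluated at the constant tuple.\<close>

lemma purification_if_no_conformal_pair:
  fixes L :: "complex^'k^'k \<Rightarrow> complex^'k^'k"
  assumes sets: "sets \<mu> = sets borel" and sf: "sigma_finite_measure \<mu>"
    and x: "x \<in> measure_support \<mu>"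
    and cont: "continuous_on UNIV L"
    and none: "\<nexists>u v. conformal_pair (L x) u v"
  shows "purification L \<mu>"
  unfolding purification_def
proof (intro allI impI, elim conjE, rule ccontr)
  fix P :: "complex^'k^'k"
  assume P: "orthogonal_projector P" "P \<noteq> 0" "rank P \<noteq> 1"
    and ae: "\<forall>n\<ge>1. AE \<omega> in (\<Pi>\<^sub>M i\<in>{1..n}. \<mu>).
            P ** ctranspose (W L n \<omega>) ** W L n \<omega> ** P \<propto> P"
  obtain u v where uv: "P *v u = u" "P *v v = v" "v \<noteq> 0" "u \<notin> vec.span {v}"
    using projector_rank_one_or_plane[OF P] .
  have herm: "ctranspose P = P" using P(1) by (simp add: orthogonal_projector_def)
  let ?A = "(*v) (L x)"
  have eq: "norm ((?A ^^ n) z) * norm v = norm ((?A ^^ n) v) * norm z" if z: "P *v z = z" for n z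
  proof (cases "n = 0")
    case False
    let ?C = "{\<omega>. norm (W L n \<omega> *v z) * norm v = norm (W L n \<omega> *v v) * norm z}"
    have "closed ?C" by (intro closed_Collect_eq continuous_intros continuous_on_W cont)
    moreover have "AE \<omega> in (\<Pi>\<^sub>M i\<in>{1..n}. \<mu>). \<omega> \<in> ?C"
    proof (rule AE_mp[OF ae[rule_format, of n]], use False in simp, intro AE_I2 impI)
      fix \<omega> assume "P ** ctranspose (W L n \<omega>) ** W L n \<omega> ** P \<propto> P"
      then obtain c where "\<And>z. P *v z = z \<Longrightarrow> norm (W L n \<omega> *v z) = c * norm z"
        using scaled_isometry_on_projector_range[OF herm] by metis
      then show "\<omega> \<in> ?C" using z uv(2) by simp
    qed
    ultimately have "(\<lambda>i\<in>{1..n}. x) \<in> ?C" by (rule AE_PiM_closed_at_support[OF sets sf x])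
    then show ?thesis by (simp add: W_constant)
  qed simp
  have "\<exists>c. \<forall>a b. norm ((?A ^^ n) (a *s u + b *s v)) = c * norm (a *s u + b *s v)" for n
  proof (intro exI allI)
    fix a b
    have "P *v (a *s u + b *s v) = a *s u + b *s v"
      by (simp add: matrix_vector_right_distrib vector_scalar_commute uv)
    from eq[OF this, of n]
    show "norm ((?A ^^ n) (a *s u + b *s v))
        = norm ((?A ^^ n) v) / norm v * norm (a *s u + b *s v)"
      using uv(3) by (simp add: field_simps)
  qed
  then show False
    using conformal_pair_if_independent[OF uv(3,4)] none by blast
qed

section \<open>Genericity\<close>

lemma continuous_on_bcontfun_eval:
  "continuous_on UNIV (\<lambda>L :: 'a::topological_space \<Rightarrow>\<^sub>C 'b::metric_space. apply_bcontfun L x)"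
  unfolding continuous_on_iff using dist_bounded order_le_less_trans by blast

theorem proposition9p1:
  fixes \<mu> :: "(complex^'k^'k) measure"
  assumes "sets \<mu> = sets borel"
    and "sigma_finite_measure \<mu>"
    and "\<exists>x\<in>measure_support \<mu>. \<exists>y\<in>measure_support \<mu>. x \<noteq> y"
  shows "generic {L :: (complex^'k^'k) \<Rightarrow>\<^sub>C (complex^'k^'k). purification (apply_bcontfun L) \<mu>}"
proof -
  obtain x where x: "x \<in> measure_support \<mu>" using assms(3) by blast
  let ?G = "{A :: complex^'k^'k. \<nexists>u v. conformal_pair A u v}"
  let ?U = "(\<lambda>L :: (complex^'k^'k) \<Rightarrow>\<^sub>C (complex^'k^'k). apply_bcontfun L x) -` ?G"
  have "open ?U"
    using open_no_conformal_pair continuous_on_bcontfun_eval by (rule open_vimage)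
  moreover have "closure ?U = UNIV"
  proof (intro equalityI subset_UNIV subsetI)
    fix L :: "(complex^'k^'k) \<Rightarrow>\<^sub>C (complex^'k^'k)"
    have "\<exists>L'\<in>?U. dist L' L < e" if "e > 0" for e
    proof -
      obtain A where A: "norm (A - apply_bcontfun L x) < e" "A \<in> ?G"
        using dense_no_conformal_pair[OF \<open>e > 0\<close>, of "apply_bcontfun L x"] by auto
      let ?L' = "L + const_bcontfun (A - apply_bcontfun L x)"
      have "?L' \<in> ?U" using A(2) by (simp add: const_bcontfun.rep_eq)
      moreover have "dist ?L' L \<le> norm (A - apply_bcontfun L x)"
        by (rule dist_bound) (simp add: const_bcontfun.rep_eq dist_norm)
      ultimately show ?thesis using A(1) by (meson order_le_less_trans)
    qed
    then show "L \<in> closure ?U" by (auto simp: closure_approachable)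
  qed
  moreover have "?U \<subseteq> {L. purification (apply_bcontfun L) \<mu>}"
    using purification_if_no_conformal_pair[OF assms(1,2) x] by auto
  ultimately show ?thesis
    unfolding generic_def by (intro exI[of _ "{?U}"]) simp
qed

end
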